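(* Let $\mathcal{P}$ be a poset on $[p]$ and let $\rho$ be a $\mathcal{P}$-flag. Then the polynomial $\mathfrak{F}_{(\mathcal{P},\rho)}$ expands positively in the basis of slide polynomials, i.e. it is a (finite) linear combination of slide polynomials $\mathfrak{F}_a$ with nonnegative integer coefficients.
   Context: A poset $\mathcal{P}$ on $[p]=\{1,\dots,p\}$ is a partial order $\prec$ on the set $[p]$; $i\prec\!\cdot\, j$ means that $j$ covers $i$ in $\mathcal{P}$, and $<$ denotes the natural order on integers. $\mathbb{N}=\{1,2,3,\dots\}$. Given $\rho:[p]\to\mathbb{Z}$, a $(\mathcal{P},\rho)$-partition is a function $f:[p]\to\mathbb{N}$ such that (1) if $i\prec j$ then $f(i)\le f(j)$; (2) if $i\prec j$ and $i>j$ then $f(i)<f(j)$; (3) $f(i)\le\rho(i)$ for all $i$. Let $\mathscr{A}_\rho(\mathcal{P})$ be the (finite) set of all $(\mathcal{P},\rho)$-partitions and $\mathfrak{F}_{(\mathcal{P},\rho)}=\sum_{f\in\mathscr{A}_\rho(\mathcal{P})}x_{f(1)}\cdots x_{f(p)}$, a polynomial in the commuting variables $x_1,x_2,\dots$. A map $\rho$ is a $\mathcal{P}$-flag if $\rho(i)>0$ for all $i\in[p]$ and: (i) if $i\prec\!\cdot\, j$ and $i<j$, then $\rho(i)=\rho(j)$; (ii) if $i\prec\!\cdot\, j$ and $i>j$, then $\rho(i)\le\rho(j)$. A weak composition is a finite sequence of nonnegative integers; a strong composition is a finite sequence of positive integers. $\mathrm{flat}(a)$ is the strong composition obtained from $a$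 by removing its zeros. A strong composition $\beta$ refines a strong composition $\alpha$ if they have the same total sum and every partial sum $\alpha_1+\cdots+\alpha_j$ equals some partial sum $\beta_1+\cdots+\beta_{i_j}$ of $\beta$. Write $b\trianglerighteq a$ (dominance) if $b_1+\cdots+b_k\ge a_1+\cdots+a_k$ for all $k$. For a weak composition $a$ of length $n$, the slide polynomial is $\mathfrak{F}_a=\sum_b x_1^{b_1}\cdots x_n^{b_n}$, the sum over weak compositions $b$ of length $n$ with $b\trianglerighteq a$ and $\mathrm{flat}(b)$ refining $\mathrm{flat}(a)$. (Appending trailing zeros to $a$ does not change $\mathfrak{F}_a$.) Slide polynomials indexed by weak compositions (up to trailing zeros) form a basis of the polynomial ring $\mathbb{Z}[x_1,x_2,\dots]$. *)

theory Defs
  imports "HOL-Library.Poly_Mapping" "HOL-Library.FuncSet"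
begin

text \<open>
  A poset on \<open>[p]\<close> is a reflexive order relation \<open>P\<close> with
  \<open>partial_order_on {1..p} P\<close>; its strict part is \<open>\<prec>\<close>.
\<close>

definition strictly_below :: "nat rel \<Rightarrow> nat \<Rightarrow> nat \<Rightarrow> bool" where
  "strictly_below P i j \<longleftrightarrow> (i, j) \<in> P \<and> i \<noteq> j"

definition covered_by :: "nat rel \<Rightarrow> nat \<Rightarrow> nat \<Rightarrow> bool" where
  "covered_by P i j \<longleftrightarrow>
     strictly_below P i j \<and> \<not> (\<exists>k. strictly_below P i k \<and> strictly_below P k j)"

text \<open>
  Integer polynomials in \<open>x\<^sub>0, x\<^sub>1, x\<^sub>2, \<dots>\<close>, as finitely supported maps from
  exponent vectors to coefficients. The variable \<open>x\<^sub>0\<close> is never used below.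
\<close>

type_synonym polynomial = "(nat \<Rightarrow>\<^sub>0 nat) \<Rightarrow>\<^sub>0 int"

definition Var :: "nat \<Rightarrow> polynomial" where
  "Var i = Poly_Mapping.single (Poly_Mapping.single i 1) 1"

text \<open>
  Functions on \<open>[p]\<close> are extensional, i.e. \<open>undefined\<close> outside \<open>{1..p}\<close>,
  so that each one is counted once.
\<close>

definition flagged_partitions :: "nat \<Rightarrow> nat rel \<Rightarrow> (nat \<Rightarrow> int) \<Rightarrow> (nat \<Rightarrow> nat) set" where
  "flagged_partitions p P \<rho> = {f \<in> {1..p} \<rightarrow>\<^sub>E {1..}.
     (\<forall>i\<in>{1..p}. \<forall>j\<in>{1..p}. strictly_below P i j \<longrightarrow> f i \<le> f j) \<and>
     (\<forall>i\<in>{1..p}. \<forall>j\<in>{1..p}. strictly_below P i j \<and> i > j \<longrightarrow> f i < f j) \<and>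
     (\<forall>i\<in>{1..p}. int (f i) \<le> \<rho> i)}"

lemma finite_flagged_partitions: "finite (flagged_partitions p P \<rho>)"
proof (rule finite_subset)
  show "flagged_partitions p P \<rho> \<subseteq> (\<Pi>\<^sub>E i\<in>{1..p}. {..nat (\<rho> i)})"
    by (force simp: flagged_partitions_def PiE_iff)
qed (auto intro: finite_PiE)

definition flagged_poly :: "nat \<Rightarrow> nat rel \<Rightarrow> (nat \<Rightarrow> int) \<Rightarrow> polynomial" where
  "flagged_poly p P \<rho> = (\<Sum>f\<in>flagged_partitions p P \<rho>. \<Prod>i=1..p. Var (f i))"

definition is_flag :: "nat \<Rightarrow> nat rel \<Rightarrow> (nat \<Rightarrow> int) \<Rightarrow> bool" where
  "is_flag p P \<rho> \<longleftrightarrow>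
     (\<forall>i\<in>{1..p}. \<rho> i > 0) \<and>
     (\<forall>i\<in>{1..p}. \<forall>j\<in>{1..p}. covered_by P i j \<and> i < j \<longrightarrow> \<rho> i = \<rho> j) \<and>
     (\<forall>i\<in>{1..p}. \<forall>j\<in>{1..p}. covered_by P i j \<and> i > j \<longrightarrow> \<rho> i \<le> \<rho> j)"

text \<open>Weak compositions are lists of type \<^typ>\<open>nat list\<close>; the entry \<open>a\<^sub>i\<close> is \<open>a ! (i - 1)\<close>.\<close>

definition flat :: "nat list \<Rightarrow> nat list" where
  "flat a = filter (\<lambda>m. m \<noteq> 0) a"

definition refines :: "nat list \<Rightarrow> nat list \<Rightarrow> bool" where
  "refines \<beta> \<alpha> \<longleftrightarrow> sum_list \<beta> = sum_list \<alpha> \<and>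
     (\<forall>j\<le>length \<alpha>. \<exists>i\<le>length \<beta>. sum_list (take j \<alpha>) = sum_list (take i \<beta>))"

definition dominates :: "nat list \<Rightarrow> nat list \<Rightarrow> bool" where
  "dominates b a \<longleftrightarrow> (\<forall>k. sum_list (take k b) \<ge> sum_list (take k a))"

definition slide_support :: "nat list \<Rightarrow> nat list set" where
  "slide_support a = {b. length b = length a \<and> dominates b a \<and> refines (flat b) (flat a)}"

lemma finite_slide_support: "finite (slide_support a)"
proof (rule finite_subset)
  have flat_sum: "sum_list (flat c) = sum_list c" for c
    by (induction c) (auto simp: flat_def)
  show "slide_support a \<subseteq> {b. set b \<subseteq> {..sum_list a} \<and> length b = length a}"
    by (auto simp: slide_support_def refines_def flat_sum dest: member_le_sum_list)
qed (rule finite_lists_length_eq, simp)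

definition slide_poly :: "nat list \<Rightarrow> polynomial" where
  "slide_poly a = (\<Sum>b\<in>slide_support a. \<Prod>i=1..length a. Var i ^ (b ! (i - 1)))"

text \<open>
  Trailing zeros do not change a slide polynomial, so the slide basis is indexed by the
  weak compositions without trailing zeros.
\<close>

definition slide_index :: "nat list set" where
  "slide_index = {a. a = [] \<or> last a \<noteq> 0}"

definition slide_positive :: "polynomial \<Rightarrow> bool" where
  "slide_positive F \<longleftrightarrow> (\<exists>A c. finite A \<and> A \<subseteq> slide_index \<and> (\<forall>a\<in>A. (c a :: int) \<ge> 0) \<and>
     F = (\<Sum>a\<in>A. of_int (c a) * slide_poly a))"

end

theory Submission
  imports Defs "HOL-Library.Multiset" "HOL-Library.Product_Lexorder"
begin

text \<open>
  The sum over all flagged partitions splits into sums over linear orders, as in Stanley's theory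
  of \<open>P\<close>-partitions, and each of these smaller sums is a single slide polynomial.

  The delicate point is how to break ties. If two elements with equal values are listed by
  increasing label, as is usual, a linear order may contribute a polynomial that is not
  slide-positive: for the antichain on \<open>{1, 2}\<close> with \<open>\<rho> 1 = 2\<close> and \<open>\<rho> 2 = 3\<close>, the order \<open>1, 2\<close>
  would contribute the sum of \<open>x\<^sub>i x\<^sub>j\<close> over \<open>i \<le> j\<close>, \<open>i \<le> 2\<close>, \<open>j \<le> 3\<close>, whose slide expansion has a
  negative coefficient. The remedy is to list tied elements by \<^emph>\<open>decreasing\<close> \<open>\<rho>\<close> first and only
  then by increasing label, that is, by the key \<open>(- \<rho> i, i)\<close>. Along the poset order a flag is
  weakly increasing, and it is constant along a chain on which a flagged partition \<open>f\<close> is constant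
  (\<open>flag_mono\<close>, \<open>flag_constant_on_level\<close>). Hence comparable elements with the same
  value are listed in poset order, and wherever the label decreases along the poset order the key
  decreases as well, which enforces the strict inequality required there. So the flagged partitions that
  are listed in a given order \<open>w\<close> are all the fillings of \<open>w\<close> that are bounded by \<open>\<rho>\<close>, increase
  weakly, and increase strictly wherever the key decreases (\<open>reading_order_fibre\<close>).

  Fix such a \<open>w\<close>. In a run of increasing key \<open>\<rho>\<close> decreases weakly, so the bound at the last element
  of the run implies those at the others; a run must also stay strictly below the next run.
  Tightening the bounds from right to left gives a word \<open>t\<close> that is constant on the runs and jumps
  between them (\<open>bounded_iff_tight_bounds\<close>, \<open>tight_bounds_steps\<close>). The fillings are now the
  sorted words \<open>s \<le> t\<close> that jump wherever \<open>t\<close> jumps. Passing from a sorted word to its vector of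
  letter counts turns pointwise comparison into dominance and the jump condition into refinement,
  so the fillings sum to the slide polynomial indexed by the letter counts of \<open>t\<close>
  (\<open>slide_poly_content\<close>).
\<close>

section \<open>Partial sums and refinement\<close>

definition partial_sums :: "nat list \<Rightarrow> nat set" where
  "partial_sums c = (\<lambda>k. sum_list (take k c)) ` {..length c}"

lemma partial_sums_Nil [simp]: "partial_sums [] = {0}"
  by (simp add: partial_sums_def)

lemma partial_sums_Cons: "partial_sums (x # c) = insert 0 ((+) x ` partial_sums c)"
  by (simp add: partial_sums_def atMost_Suc_eq_insert_0 image_image)

lemma zero_in_partial_sums: "0 \<in> partial_sums c"
  by (cases c) (simp_all add: partial_sums_Cons)

text \<open>
  A zero entry only repeats a partial sum, which a set does not see.
\<close>

lemma partial_sums_flat: "partial_sums (flat c) = partial_sums c"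
proof (induction c)
  case (Cons x c)
  then show ?case
    using zero_in_partial_sums[of c]
    by (cases "x = 0") (auto simp: flat_def partial_sums_Cons insert_absorb image_iff)
qed (simp add: flat_def)

lemma sum_list_flat: "sum_list (flat c) = sum_list c"
  by (induction c) (auto simp: flat_def)

lemma refines_flat_iff:
  "refines (flat b) (flat a) \<longleftrightarrow> sum_list b = sum_list a \<and> partial_sums a \<subseteq> partial_sums b"
proof -
  have "refines \<beta> \<alpha> \<longleftrightarrow> sum_list \<beta> = sum_list \<alpha> \<and> partial_sums \<alpha> \<subseteq> partial_sums \<beta>" for \<alpha> \<beta>
    unfolding refines_def partial_sums_def by (auto simp: image_iff subset_iff)
  then show ?thesis
    by (simp add: partial_sums_flat sum_list_flat)
qed

section \<open>Slide polynomials as sums over words\<close>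

definition content :: "nat \<Rightarrow> nat list \<Rightarrow> nat list" where
  "content n s = map (count_list s) [1..<Suc n]"

lemma length_content [simp]: "length (content n s) = n"
  by (simp add: content_def)

lemma nth_content: "i \<in> {1..n} \<Longrightarrow> content n s ! (i - 1) = count_list s i"
  by (auto simp: content_def simp del: upt_Suc)

lemma length_filter_le_Suc:
  "length (filter (\<lambda>x. x \<le> Suc m) s) = length (filter (\<lambda>x. x \<le> m) s) + count_list s (Suc m)"
  by (induction s) auto

lemma sum_take_content:
  assumes "0 \<notin> set s"
  shows "sum_list (take k (content n s)) = length (filter (\<lambda>x. x \<le> min k n) s)"
proof -
  have "sum_list (map (count_list s) [1..<Suc m]) = length (filter (\<lambda>x. x \<le> m) s)" for m
  proof (induction m)
    case 0
    show ?case using assms by (auto simp: filter_empty_conv intro: gr0I)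
  next
    case (Suc m)
    then show ?case by (simp add: length_filter_le_Suc)
  qed
  moreover have "take k [1..<Suc n] = [1..<Suc (min k n)]"
    by (cases "k \<le> n") (auto simp: min_def take_upt simp del: upt_Suc)
  ultimately show ?thesis
    by (simp add: content_def take_map del: upt_Suc)
qed

lemma sum_list_content:
  assumes "set s \<subseteq> {1..n}"
  shows "sum_list (content n s) = length s"
proof -
  have "filter (\<lambda>x. x \<le> n) s = s"
    using assms by (auto simp: filter_id_conv)
  moreover have "0 \<notin> set s" using assms by auto
  ultimately show ?thesis
    using sum_take_content[of s n n] by simp
qed

text \<open>
  The link between the entries of a sorted word and its letter counts: the entries up to \<open>k\<close> form
  an initial segment.
\<close>

lemma sorted_nth_le_iff:
  fixes s :: "'a::linorder list"
  assumes "sorted s" "i < length s"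
  shows "s ! i \<le> k \<longleftrightarrow> i < length (filter (\<lambda>x. x \<le> k) s)"
  using assms
proof (induction s arbitrary: i)
  case (Cons x s)
  show ?case
  proof (cases "x \<le> k")
    case True
    then show ?thesis using Cons by (cases i) auto
  next
    case False
    then have "filter (\<lambda>y. y \<le> k) (x # s) = []"
      using Cons.prems(1) by (auto simp: filter_empty_conv)
    moreover have "x \<le> (x # s) ! i"
      using Cons.prems by (cases i) auto
    ultimately show ?thesis using False by auto
  qed
qed simp

text \<open>
  The partial sums of the content count the entries up to \<open>k\<close>. Both sides say that for every \<open>k\<close>
  the initial segment of entries up to \<open>k\<close> is at least as long in \<open>s\<close> as in \<open>t\<close>.
\<close>

lemma dominates_content_iff:
  assumes "sorted s" "sorted t" "set s \<subseteq> {1..n}" "set t \<subseteq> {1..n}" "length s = length t"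
  shows "dominates (content n s) (content n t) \<longleftrightarrow> (\<forall>i<length t. s ! i \<le> t ! i)"
proof -
  have nz: "0 \<notin> set s" "0 \<notin> set t" using assms by auto
  have "(\<forall>k. length (filter (\<lambda>x. x \<le> min k n) t) \<le> length (filter (\<lambda>x. x \<le> min k n) s))
    \<longleftrightarrow> (\<forall>i<length t. s ! i \<le> t ! i)" (is "?L \<longleftrightarrow> ?R")
  proof
    assume L: ?L
    show ?R
    proof (intro allI impI)
      fix i assume i: "i < length t"
      then have "t ! i \<le> n" using assms(4) nth_mem by fastforce
      then have "length (filter (\<lambda>x. x \<le> t ! i) t) \<le> length (filter (\<lambda>x. x \<le> t ! i) s)"
        using L[rule_format, of "t ! i"] by (simp add: min_def)
      moreover have "i < length (filter (\<lambda>x. x \<le> t ! i) t)"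
        using sorted_nth_le_iff[OF assms(2) i, of "t ! i"] by simp
      ultimately show "s ! i \<le> t ! i"
        using sorted_nth_le_iff[OF assms(1), of i "t ! i"] i assms(5) by simp
    qed
  next
    assume R: ?R
    show ?L
    proof
      fix k
      let ?N = "\<lambda>u. length (filter (\<lambda>x. x \<le> min k n) u)"
      show "?N t \<le> ?N s"
      proof (rule ccontr)
        assume "\<not> ?thesis"
        then have lt: "?N s < ?N t" by simp
        then have l: "?N s < length t"
          using length_filter_le[of "\<lambda>x. x \<le> min k n" t] by linarith
        then have "t ! ?N s \<le> min k n"
          using sorted_nth_le_iff[OF assms(2) l] lt by blast
        then have "s ! ?N s \<le> min k n" using R l le_trans by blast
        then show False using sorted_nth_le_iff[OF assms(1), of "?N s" "min k n"] l assms(5) by simp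
      qed
    qed
  qed
  then show ?thesis
    by (simp add: dominates_def sum_take_content nz)
qed

text \<open>
  The initial segment of entries up to some \<open>k\<close> can end only where the word jumps, and \<open>k\<close> equal
  to the entry before the jump makes it end there.
\<close>

lemma partial_sums_content_iff:
  assumes "sorted s" "set s \<subseteq> {1..n}"
  shows "m \<in> partial_sums (content n s) \<longleftrightarrow>
    m = 0 \<or> m = length s \<or> (0 < m \<and> m < length s \<and> s ! (m - 1) < s ! m)"
proof -
  have nz: "0 \<notin> set s" using assms by auto
  let ?N = "\<lambda>k. length (filter (\<lambda>x. x \<le> k) s)"
  have mem: "m \<in> partial_sums (content n s) \<longleftrightarrow> (\<exists>k\<le>n. m = ?N k)"
    by (auto simp: partial_sums_def sum_take_content[OF nz] image_iff min_def)
  show ?thesis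
  proof (cases "0 < m \<and> m < length s")
    case True
    then have l: "m - 1 < length s" "m < length s" by auto
    have "(\<exists>k\<le>n. m = ?N k) \<longleftrightarrow> s ! (m - 1) < s ! m"
    proof
      assume "\<exists>k\<le>n. m = ?N k"
      then obtain k where "m = ?N k" by blast
      then have "s ! (m - 1) \<le> k" "\<not> s ! m \<le> k"
        using sorted_nth_le_iff[OF assms(1) l(1), of k] sorted_nth_le_iff[OF assms(1) l(2), of k] True
        by auto
      then show "s ! (m - 1) < s ! m" by simp
    next
      assume "s ! (m - 1) < s ! m"
      then have "m - 1 < ?N (s ! (m - 1))" "\<not> m < ?N (s ! (m - 1))"
        using sorted_nth_le_iff[OF assms(1) l(1), of "s ! (m - 1)"]
          sorted_nth_le_iff[OF assms(1) l(2), of "s ! (m - 1)"] by auto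
      then have "m = ?N (s ! (m - 1))" using True by linarith
      moreover have "s ! (m - 1) \<le> n" using assms(2) l nth_mem by fastforce
      ultimately show "\<exists>k\<le>n. m = ?N k" by blast
    qed
    then show ?thesis using True mem by auto
  next
    case False
    have "?N 0 = 0" using nz by (auto simp: filter_empty_conv intro: gr0I)
    moreover have "?N n = length s"
      using assms(2) by (metis (no_types, lifting) atLeastAtMost_iff filter_True subsetD)
    moreover have "?N k \<le> length s" for k by simp
    ultimately show ?thesis using False mem by (metis le_less not_gr_zero zero_le order_refl)
  qed
qed

text \<open>
  Refinement is containment of the sets of partial sums, hence of the sets of jump positions.
\<close>

lemma refines_content_iff:
  assumes "sorted s" "sorted t" "set s \<subseteq> {1..n}" "set t \<subseteq> {1..n}" "length s = length t"
  shows "refines (flat (content n s)) (flat (content n t)) \<longleftrightarrow>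
    (\<forall>i. Suc i < length t \<longrightarrow> t ! i < t ! Suc i \<longrightarrow> s ! i < s ! Suc i)"
proof -
  have "refines (flat (content n s)) (flat (content n t)) \<longleftrightarrow>
    (\<forall>m. 0 < m \<longrightarrow> m < length t \<longrightarrow> t ! (m - 1) < t ! m \<longrightarrow> s ! (m - 1) < s ! m)"
    using assms
    by (auto simp: refines_flat_iff sum_list_content subset_iff partial_sums_content_iff)
  also have "\<dots> \<longleftrightarrow> (\<forall>i. Suc i < length t \<longrightarrow> t ! i < t ! Suc i \<longrightarrow> s ! i < s ! Suc i)"
    by (metis diff_Suc_1 gr0_conv_Suc zero_less_Suc)
  finally show ?thesis .
qed

lemma content_bij:
  "bij_betw (content n) {s. sorted s \<and> set s \<subseteq> {1..n}} {b. length b = n}"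
proof (rule bij_betw_imageI)
  show "inj_on (content n) {s. sorted s \<and> set s \<subseteq> {1..n}}"
  proof (rule inj_onI, clarify)
    fix s s' :: "nat list"
    assume s: "sorted s" "set s \<subseteq> {1..n}" "sorted s'" "set s' \<subseteq> {1..n}"
      and eq: "content n s = content n s'"
    have "count_list s i = count_list s' i" for i
    proof (cases "i \<in> {1..n}")
      case True
      then show ?thesis using eq nth_content[of i n] by metis
    next
      case False
      then have "i \<notin> set s" "i \<notin> set s'" using s by auto
      then show ?thesis by (simp add: count_list_0_iff)
    qed
    then have "mset s = mset s'" by (simp add: multiset_eq_iff count_mset)
    then show "s = s'" using s by (metis properties_for_sort)
  qed
  show "content n ` {s. sorted s \<and> set s \<subseteq> {1..n}} = {b. length b = n}"
  proof (intro equalityI subsetI)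
    fix b :: "nat list" assume "b \<in> {b. length b = n}"
    then have b: "length b = n" by simp
    define M where "M = (\<Sum>i\<in>{1..n}. replicate_mset (b ! (i - 1)) i)"
    have cnt: "count M i = (if i \<in> {1..n} then b ! (i - 1) else 0)" for i
      unfolding M_def by (simp add: count_sum if_distrib sum.delta cong: if_cong)
    \<comment> \<open>The sorted word with content \<open>b\<close> lists the multiset with multiplicities \<open>b\<close> in order.\<close>
    let ?s = "sorted_list_of_multiset M"
    have "set ?s \<subseteq> {1..n}"
      using cnt by (auto simp: count_greater_zero_iff[symmetric] split: if_splits)
    moreover have "content n ?s = b"
    proof (rule nth_equalityI)
      fix i assume "i < length (content n ?s)"
      then have i: "Suc i \<in> {1..n}" by simp
      then have "content n ?s ! i = count (mset ?s) (Suc i)"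
        using nth_content[OF i] by (simp only: count_mset diff_Suc_1)
      then show "content n ?s ! i = b ! i" using i cnt by simp
    qed (simp add: b)
    ultimately show "b \<in> content n ` {s. sorted s \<and> set s \<subseteq> {1..n}}"
      by (intro image_eqI[of _ _ ?s]) auto
  qed auto
qed

lemma prod_count_list:
  fixes g :: "'a \<Rightarrow> 'b::comm_monoid_mult"
  assumes "finite A" "set s \<subseteq> A"
  shows "(\<Prod>i\<in>A. g i ^ count_list s i) = prod_list (map g s)"
  using assms(2)
proof (induction s)
  case (Cons x s)
  have "(\<Prod>i\<in>A. g i ^ count_list (x # s) i) = (\<Prod>i\<in>A. (if i = x then g i else 1) * g i ^ count_list s i)"
    by (rule prod.cong) auto
  also have "\<dots> = g x * (\<Prod>i\<in>A. g i ^ count_list s i)"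
    using assms(1) Cons.prems by (simp add: prod.distrib prod.delta)
  finally show ?case using Cons by simp
qed simp

definition words_below :: "nat list \<Rightarrow> nat list set" where
  "words_below t = {s. length s = length t \<and> sorted s \<and> 0 \<notin> set s \<and>
     (\<forall>i. Suc i < length t \<longrightarrow> t ! i < t ! Suc i \<longrightarrow> s ! i < s ! Suc i) \<and>
     (\<forall>i<length t. s ! i \<le> t ! i)}"

lemma slide_poly_content:
  assumes "sorted t" "set t \<subseteq> {1..n}"
  shows "slide_poly (content n t) = (\<Sum>s\<in>words_below t. prod_list (map Var s))"
proof -
  have bounded: "set s \<subseteq> {1..n}" if "s \<in> words_below t" for s
  proof
    fix x assume x: "x \<in> set s"
    then obtain i where i: "i < length s" "x = s ! i" by (auto simp: in_set_conv_nth)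
    then have "s ! i \<le> t ! i" "t ! i \<in> set t" using that by (auto simp: words_below_def)
    then have "x \<le> n" using assms(2) i by fastforce
    moreover have "x \<noteq> 0" using x that by (cases "x = 0") (auto simp: words_below_def)
    ultimately show "x \<in> {1..n}" by simp
  qed
  have iff: "s \<in> words_below t \<longleftrightarrow> content n s \<in> slide_support (content n t)"
    if "sorted s" "set s \<subseteq> {1..n}" for s
  proof (cases "length s = length t")
    case True
    then show ?thesis
      using dominates_content_iff[OF that(1) assms(1) that(2) assms(2)]
        refines_content_iff[OF that(1) assms(1) that(2) assms(2)] that
      by (auto simp: words_below_def slide_support_def)
  next
    case False
    then show ?thesis using that assms
      by (simp add: words_below_def slide_support_def refines_flat_iff sum_list_content)
  qed
  have "bij_betw (content n) (words_below t) (slide_support (content n t))"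
  proof (rule bij_betw_imageI)
    show "inj_on (content n) (words_below t)"
      by (rule inj_on_subset[OF bij_betw_imp_inj_on[OF content_bij[of n]]])
        (use bounded in \<open>auto simp: words_below_def\<close>)
    show "content n ` words_below t = slide_support (content n t)"
    proof (intro equalityI subsetI)
      fix b assume "b \<in> content n ` words_below t"
      then show "b \<in> slide_support (content n t)"
        using iff bounded by (auto simp: words_below_def)
    next
      fix b assume b: "b \<in> slide_support (content n t)"
      then have "b \<in> {b. length b = n}" by (simp add: slide_support_def)
      then obtain s where "sorted s" "set s \<subseteq> {1..n}" "b = content n s"
        using bij_betw_imp_surj_on[OF content_bij[of n]] by blast
      then show "b \<in> content n ` words_below t" using iff b by blast
    qed
  qed
  then have "slide_poly (content n t) =
      (\<Sum>s\<in>words_below t. \<Prod>i=1..n. Var i ^ (content n s ! (i - 1)))"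
    unfolding slide_poly_def by (simp add: sum.reindex_bij_betw[symmetric])
  also have "\<dots> = (\<Sum>s\<in>words_below t. prod_list (map Var s))"
  proof (rule sum.cong[OF refl])
    fix s assume "s \<in> words_below t"
    then have "(\<Prod>i=1..n. Var i ^ count_list s i) = prod_list (map Var s)"
      using bounded by (intro prod_count_list) auto
    then show "(\<Prod>i=1..n. Var i ^ (content n s ! (i - 1))) = prod_list (map Var s)"
      by (simp only: nth_content cong: prod.cong)
  qed
  finally show ?thesis .
qed

section \<open>One linear order at a time\<close>

text \<open>
  Stanley's strictness rule for the labelling \<open>k\<close>: the lexicographic comparison lets \<open>f\<close> stay
  constant from one element of \<open>w\<close> to the next only if \<open>k\<close> increases there.
\<close>

definition compatible :: "('a \<Rightarrow> 'b::linorder) \<Rightarrow> 'a list \<Rightarrow> ('a \<Rightarrow> nat) \<Rightarrow> bool" where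
  "compatible k w f \<longleftrightarrow> successively (\<lambda>x y. (f x, k x) < (f y, k y)) w"

text \<open>
  For \<open>R\<close> antitone in \<open>k\<close>, these are the largest values that a compatible filling of \<open>w\<close> bounded
  by \<open>R\<close> can take. Where \<open>k\<close> increases, antitonicity makes \<open>R x\<close> at least the bound inherited
  from the right, so the latter is the tight one. Subtraction is truncated, and a bound 0 signals
  that there is no filling with positive values.
\<close>

fun tight_bounds :: "('a \<Rightarrow> 'b::linorder) \<Rightarrow> ('a \<Rightarrow> nat) \<Rightarrow> 'a list \<Rightarrow> nat list" where
  "tight_bounds k R [] = []"
| "tight_bounds k R [x] = [R x]"
| "tight_bounds k R (x # y # w) =
    (let t = tight_bounds k R (y # w)
     in (if k x < k y then hd t else min (R x) (hd t - 1)) # t)"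

lemma length_tight_bounds [simp]: "length (tight_bounds k R w) = length w"
  by (induction k R w rule: tight_bounds.induct) (simp_all add: Let_def)

lemma tight_bounds_Cons_eq: "\<exists>h t. tight_bounds k R (y # w) = h # t"
  using length_tight_bounds[of k R "y # w"] by (metis length_Suc_conv)

text \<open>
  By induction from the right. At a step where \<open>k\<close> increases, \<open>f x \<le> f y\<close> makes the bound of \<open>y\<close>
  valid for \<open>x\<close>, and it implies \<open>f x \<le> R x\<close> because \<open>R y \<le> R x\<close>. At any other step \<open>f x < f y\<close>,
  whence the decrement.
\<close>

lemma bounded_iff_tight_bounds:
  assumes "compatible k w f"
    and "\<And>x y. x \<in> set w \<Longrightarrow> y \<in> set w \<Longrightarrow> k x < k y \<Longrightarrow> R y \<le> R x"
  shows "(\<forall>x\<in>set w. f x \<le> R x) \<longleftrightarrow> list_all2 (\<le>) (map f w) (tight_bounds k R w)"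
  using assms
proof (induction k R w rule: tight_bounds.induct)
  case (3 k R x y w)
  obtain h t where t: "tight_bounds k R (y # w) = h # t"
    using tight_bounds_Cons_eq[of k R y w] by blast
  have IH: "(\<forall>z\<in>set (y # w). f z \<le> R z) \<longleftrightarrow> list_all2 (\<le>) (map f (y # w)) (h # t)"
    using 3 by (simp add: compatible_def t)
  have step: "f x < f y \<or> f x = f y \<and> k x < k y"
    using "3.prems"(1) by (auto simp: compatible_def)
  have anti: "k x < k y \<Longrightarrow> R y \<le> R x"
    using "3.prems"(2)[of x y] by simp
  have *: "f x \<le> R x \<longleftrightarrow> f x \<le> (if k x < k y then h else min (R x) (h - 1))"
    if "f y \<le> R y" "f y \<le> h"
    using that step anti by (cases "k x < k y") auto
  show ?case
    using IH * by (auto simp: t Let_def)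
qed auto

text \<open>
  The tight bounds jump exactly where \<open>k\<close> fails to increase. With a zero among them the truncated
  subtraction could yield 0 followed by 0 at a place where a jump is due.
\<close>

lemma tight_bounds_steps:
  assumes "0 \<notin> set (tight_bounds k R w)" "Suc i < length w"
  shows "if k (w ! i) < k (w ! Suc i)
    then tight_bounds k R w ! i = tight_bounds k R w ! Suc i
    else tight_bounds k R w ! i < tight_bounds k R w ! Suc i"
  using assms
proof (induction k R w arbitrary: i rule: tight_bounds.induct)
  case (3 k R x y w)
  obtain h t where t: "tight_bounds k R (y # w) = h # t"
    using tight_bounds_Cons_eq[of k R y w] by blast
  show ?case
  proof (cases i)
    case 0
    then show ?thesis using "3.prems"(1) by (auto simp: t Let_def)
  next
    case (Suc j)
    then show ?thesis
      using "3.IH"[of j] "3.prems" by (auto simp: t Let_def split: if_splits)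
  qed
qed auto

lemma sorted_tight_bounds:
  assumes "0 \<notin> set (tight_bounds k R w)"
  shows "sorted (tight_bounds k R w)"
  unfolding sorted_iff_nth_Suc
proof (intro allI impI)
  fix i assume "Suc i < length (tight_bounds k R w)"
  then show "tight_bounds k R w ! i \<le> tight_bounds k R w ! Suc i"
    using tight_bounds_steps[OF assms, of i] by (simp split: if_splits)
qed

lemma words_below_tight_bounds_iff:
  assumes "0 \<notin> set (tight_bounds k R w)"
    and "\<And>x y. x \<in> set w \<Longrightarrow> y \<in> set w \<Longrightarrow> k x < k y \<Longrightarrow> R y \<le> R x"
  shows "map f w \<in> words_below (tight_bounds k R w) \<longleftrightarrow>
    (\<forall>x\<in>set w. 1 \<le> f x) \<and> compatible k w f \<and> (\<forall>x\<in>set w. f x \<le> R x)"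
proof -
  let ?t = "tight_bounds k R w"
  have "sorted (map f w) \<and> (\<forall>i. Suc i < length w \<longrightarrow> ?t ! i < ?t ! Suc i \<longrightarrow> f (w ! i) < f (w ! Suc i))
    \<longleftrightarrow> (\<forall>i. Suc i < length w \<longrightarrow> f (w ! i) \<le> f (w ! Suc i) \<and>
          (?t ! i < ?t ! Suc i \<longrightarrow> f (w ! i) < f (w ! Suc i)))"
    by (auto simp: sorted_iff_nth_Suc)
  also have "\<dots> \<longleftrightarrow> compatible k w f"
  proof -
    have "f (w ! i) \<le> f (w ! Suc i) \<and> (?t ! i < ?t ! Suc i \<longrightarrow> f (w ! i) < f (w ! Suc i)) \<longleftrightarrow>
      (f (w ! i), k (w ! i)) < (f (w ! Suc i), k (w ! Suc i))" if "Suc i < length w" for i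
      using tight_bounds_steps[OF assms(1) that] by (auto split: if_splits)
    then show ?thesis by (simp add: compatible_def successively_conv_nth)
  qed
  finally have c: "sorted (map f w) \<and>
      (\<forall>i. Suc i < length w \<longrightarrow> ?t ! i < ?t ! Suc i \<longrightarrow> f (w ! i) < f (w ! Suc i)) \<longleftrightarrow> compatible k w f" .
  have "map f w \<in> words_below ?t \<longleftrightarrow> (\<forall>x\<in>set w. 1 \<le> f x) \<and> compatible k w f \<and>
      list_all2 (\<le>) (map f w) ?t"
    unfolding words_below_def c[symmetric]
    by (auto simp: list_all2_conv_all_nth Suc_le_eq gr0_conv_Suc image_iff dest: Suc_lessD intro: gr0I)
  then show ?thesis
    using bounded_iff_tight_bounds[of k w f R] assms(2) by auto
qed

definition compatible_fillings ::
    "('a \<Rightarrow> 'b::linorder) \<Rightarrow> ('a \<Rightarrow> nat) \<Rightarrow> 'a list \<Rightarrow> ('a \<Rightarrow> nat) set" where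
  "compatible_fillings k R w =
    {f \<in> set w \<rightarrow>\<^sub>E {1..}. compatible k w f \<and> (\<forall>x\<in>set w. f x \<le> R x)}"

text \<open>
  Cutting the content off at the largest letter leaves no trailing zeros; the inserted 0 covers
  the empty word.
\<close>

definition slide_index_of ::
    "('a \<Rightarrow> 'b::linorder) \<Rightarrow> ('a \<Rightarrow> nat) \<Rightarrow> 'a list \<Rightarrow> nat list" where
  "slide_index_of k R w =
    (let t = tight_bounds k R w in content (Max (insert 0 (set t))) t)"

lemma slide_index_of_in_slide_index: "slide_index_of k R w \<in> slide_index"
proof -
  let ?t = "tight_bounds k R w"
  define n where "n = Max (insert 0 (set ?t))"
  have "n \<in> insert 0 (set ?t)" unfolding n_def by (rule Max_in) auto
  then show ?thesis
    unfolding slide_index_of_def slide_index_def Let_def n_def[symmetric]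
    by (cases n) (auto simp: content_def neq0_conv[symmetric] count_list_0_iff simp del: neq0_conv)
qed

lemma sum_compatible_fillings:
  assumes "distinct w"
    and antitone: "\<And>x y. x \<in> set w \<Longrightarrow> y \<in> set w \<Longrightarrow> k x < k y \<Longrightarrow> R y \<le> R x"
    and "compatible_fillings k R w \<noteq> {}"
  shows "(\<Sum>f\<in>compatible_fillings k R w. \<Prod>x\<in>set w. Var (f x)) = slide_poly (slide_index_of k R w)"
proof -
  let ?t = "tight_bounds k R w"
  let ?n = "Max (insert 0 (set ?t))"
  \<comment> \<open>One filling with positive values already forces all tight bounds to be positive.\<close>
  obtain g where g: "g \<in> compatible_fillings k R w" using assms(3) by blast
  then have "list_all2 (\<le>) (map g w) ?t"
    using bounded_iff_tight_bounds[of k w g R] antitone by (simp add: compatible_fillings_def)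
  moreover have "\<forall>x\<in>set w. 1 \<le> g x"
    using g by (auto simp: compatible_fillings_def PiE_iff)
  ultimately have "1 \<le> ?t ! i" if "i < length w" for i
    using that nth_mem[OF that]
    by (metis le_trans length_map list_all2_conv_all_nth nth_map)
  then have nz: "0 \<notin> set ?t"
    by (metis in_set_conv_nth length_tight_bounds not_one_le_zero)
  have n: "set ?t \<subseteq> {1..?n}"
  proof
    fix x assume x: "x \<in> set ?t"
    then have "x \<le> ?n" by (intro Max_ge) auto
    moreover have "x \<noteq> 0" using nz x by metis
    ultimately show "x \<in> {1..?n}" by simp
  qed
  have fill_iff: "f \<in> compatible_fillings k R w \<longleftrightarrow>
      f \<in> extensional (set w) \<and> map f w \<in> words_below ?t" for f
  proof -
    have "map f w \<in> words_below ?t \<longleftrightarrow>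
        (\<forall>x\<in>set w. 1 \<le> f x) \<and> compatible k w f \<and> (\<forall>x\<in>set w. f x \<le> R x)"
      by (rule words_below_tight_bounds_iff[OF nz]) (rule antitone)
    then show ?thesis by (auto simp: compatible_fillings_def PiE_iff)
  qed
  have bij: "bij_betw (\<lambda>f. map f w) (compatible_fillings k R w) (words_below ?t)"
  proof (rule bij_betw_imageI)
    show "inj_on (\<lambda>f. map f w) (compatible_fillings k R w)"
      by (rule inj_onI) (auto simp: fill_iff intro: extensionalityI)
    show "(\<lambda>f. map f w) ` compatible_fillings k R w = words_below ?t"
    proof (intro equalityI subsetI)
      fix s assume s: "s \<in> words_below ?t"
      define f where "f = restrict (\<lambda>x. the (map_of (zip w s) x)) (set w)"
      have "length s = length w" using s by (simp add: words_below_def)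
      then have "map f w = s"
        using assms(1) by (auto simp: f_def map_of_zip_nth intro!: nth_equalityI)
      moreover have "f \<in> extensional (set w)" by (simp add: f_def)
      ultimately have "f \<in> compatible_fillings k R w" using s by (simp add: fill_iff)
      then show "s \<in> (\<lambda>f. map f w) ` compatible_fillings k R w"
        using \<open>map f w = s\<close> by blast
    qed (auto simp: fill_iff)
  qed
  have "(\<Sum>f\<in>compatible_fillings k R w. \<Prod>x\<in>set w. Var (f x)) =
      (\<Sum>f\<in>compatible_fillings k R w. prod_list (map Var (map f w)))"
    using assms(1) by (simp add: prod.distinct_set_conv_list comp_def)
  also have "\<dots> = (\<Sum>s\<in>words_below ?t. prod_list (map Var s))"
    by (rule sum.reindex_bij_betw[OF bij])
  also have "\<dots> = slide_poly (slide_index_of k R w)"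
    using slide_poly_content[OF sorted_tight_bounds[OF nz] n]
    by (simp add: slide_index_of_def Let_def)
  finally show ?thesis .
qed

section \<open>Splitting a poset into linear orders\<close>

text \<open>
  Flags are constrained only along covers. In a finite poset every strict relation is a composite
  of covers, so transitive consequences of the cover conditions hold throughout.
\<close>

lemma strictly_below_cover_induct:
  assumes "finite A" "partial_order_on A P" "strictly_below P i j"
    and cover: "\<And>i j. i \<in> A \<Longrightarrow> j \<in> A \<Longrightarrow> covered_by P i j \<Longrightarrow> Q i j"
    and trans: "\<And>i k j. strictly_below P i k \<Longrightarrow> strictly_below P k j \<Longrightarrow> Q i k \<Longrightarrow> Q k j \<Longrightarrow> Q i j"
  shows "Q i j"
  using assms(3)
proof (induction "card {k. strictly_below P i k \<and> strictly_below P k j}" arbitrary: i j rule: less_induct)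
  case less
  let ?I = "\<lambda>i j. {k. strictly_below P i k \<and> strictly_below P k j}"
  have sub: "P \<subseteq> A \<times> A" and tr: "trans P" and as: "antisym P"
    using assms(2) by (auto simp: partial_order_on_def preorder_on_def)
  have sb_trans: "strictly_below P a c" if "strictly_below P a b" "strictly_below P b c" for a b c
    using that tr as unfolding strictly_below_def by (metis antisymD transD)
  have fin: "finite (?I i j)"
    by (rule finite_subset[OF _ assms(1)]) (use sub in \<open>auto simp: strictly_below_def\<close>)
  show ?case
  proof (cases "covered_by P i j")
    case True
    then show ?thesis using cover sub less.prems by (auto simp: strictly_below_def)
  next
    case False
    then obtain k where k: "strictly_below P i k" "strictly_below P k j"
      using less.prems by (auto simp: covered_by_def)
    have "k \<in> ?I i j" "k \<notin> ?I i k" "k \<notin> ?I k j"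
      using k by (auto simp: strictly_below_def)
    moreover have "?I i k \<subseteq> ?I i j" "?I k j \<subseteq> ?I i j"
      using k sb_trans by blast+
    ultimately have "card (?I i k) < card (?I i j)" "card (?I k j) < card (?I i j)"
      by (blast intro: psubset_card_mono[OF fin])+
    then have "Q i k" "Q k j"
      using less.hyps k by blast+
    then show ?thesis using trans k by blast
  qed
qed

lemma flag_mono:
  assumes "partial_order_on {1..p} P" "is_flag p P \<rho>" "strictly_below P i j"
  shows "\<rho> i \<le> \<rho> j"
proof (rule strictly_below_cover_induct[OF _ assms(1,3)])
  fix i j assume ij: "i \<in> {1..p}" "j \<in> {1..p}" "covered_by P i j"
  then have "i < j \<or> j < i" by (auto simp: covered_by_def strictly_below_def)
  then show "\<rho> i \<le> \<rho> j"
    using assms(2) ij unfolding is_flag_def by force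
qed auto

text \<open>
  If \<open>f\<close> takes equal values at \<open>i \<prec> j\<close>, it is constant along a chain of covers from \<open>i\<close> to \<open>j\<close>. None
  of these covers decreases the label, since \<open>f\<close> would grow there, and a flag is constant along
  the covers that increase the label.
\<close>

lemma flag_constant_on_level:
  assumes "partial_order_on {1..p} P" "is_flag p P \<rho>" "f \<in> flagged_partitions p P \<rho>"
    and "strictly_below P i j" "f i = f j"
  shows "\<rho> i = \<rho> j"
proof -
  have "P \<subseteq> {1..p} \<times> {1..p}"
    using assms(1) by (auto simp: partial_order_on_def preorder_on_def)
  then have mono: "f a \<le> f b" if "strictly_below P a b" for a b
    using assms(3) that unfolding flagged_partitions_def strictly_below_def by blast
  have "f i = f j \<longrightarrow> \<rho> i = \<rho> j"
  proof (rule strictly_below_cover_induct[OF _ assms(1,4)])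
    fix i j assume ij: "i \<in> {1..p}" "j \<in> {1..p}" "covered_by P i j"
    then have "strictly_below P i j" by (simp add: covered_by_def)
    then have "i < j \<or> f i < f j"
      using assms(3) ij by (cases "i < j") (auto simp: strictly_below_def flagged_partitions_def)
    then show "f i = f j \<longrightarrow> \<rho> i = \<rho> j"
      using assms(2) ij unfolding is_flag_def by force
  next
    fix i k j assume "strictly_below P i k" "strictly_below P k j"
      and IH: "f i = f k \<longrightarrow> \<rho> i = \<rho> k" "f k = f j \<longrightarrow> \<rho> k = \<rho> j"
    then have "f i \<le> f k" "f k \<le> f j" using mono by auto
    then show "f i = f j \<longrightarrow> \<rho> i = \<rho> j" using IH by auto
  qed simp
  then show ?thesis using assms(5) by simp
qed

text \<open>
  The tie-breaking rule: a larger \<open>\<rho>\<close> comes first, then a smaller label.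
\<close>

definition flag_key :: "(nat \<Rightarrow> int) \<Rightarrow> nat \<Rightarrow> int \<times> nat" where
  "flag_key \<rho> i = (- \<rho> i, i)"

definition reading_order :: "nat \<Rightarrow> (nat \<Rightarrow> int) \<Rightarrow> (nat \<Rightarrow> nat) \<Rightarrow> nat list" where
  "reading_order p \<rho> f = sort_key (\<lambda>i. (f i, flag_key \<rho> i)) [1..<Suc p]"

lemma set_reading_order [simp]: "set (reading_order p \<rho> f) = {1..p}"
  and distinct_reading_order [simp]: "distinct (reading_order p \<rho> f)"
  by (auto simp: reading_order_def simp del: upt_Suc)

lemma reading_order_sorted:
  "sorted_wrt (\<lambda>x y. (f x, flag_key \<rho> x) < (f y, flag_key \<rho> y)) (reading_order p \<rho> f)"
proof -
  let ?K = "\<lambda>i. (f i, flag_key \<rho> i)"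
  have "inj_on ?K (set (reading_order p \<rho> f))"
    by (auto simp: inj_on_def flag_key_def)
  then have "distinct (map ?K (reading_order p \<rho> f))"
    by (simp add: distinct_map)
  moreover have "sorted (map ?K (reading_order p \<rho> f))"
    unfolding reading_order_def by (rule sorted_sort_key)
  ultimately have "sorted_wrt (<) (map ?K (reading_order p \<rho> f))"
    by (simp add: strict_sorted_iff)
  then show ?thesis by (simp add: sorted_wrt_map)
qed

lemma compatible_iff_sorted_wrt:
  "compatible k w f \<longleftrightarrow> sorted_wrt (\<lambda>x y. (f x, k x) < (f y, k y)) w"
  unfolding compatible_def by (rule successively_iff_sorted_wrt_strong) (rule less_trans)

lemma reading_order_eq_iff:
  assumes "set w = {1..p}"
  shows "reading_order p \<rho> f = w \<longleftrightarrow> compatible (flag_key \<rho>) w f"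
proof
  assume "reading_order p \<rho> f = w"
  then show "compatible (flag_key \<rho>) w f"
    using reading_order_sorted compatible_iff_sorted_wrt by blast
next
  let ?K = "\<lambda>i. (f i, flag_key \<rho> i)"
  assume "compatible (flag_key \<rho>) w f"
  then have "sorted_wrt (<) (map ?K w)"
    by (simp add: compatible_iff_sorted_wrt sorted_wrt_map)
  moreover have "sorted_wrt (<) (map ?K (reading_order p \<rho> f))"
    using reading_order_sorted by (simp add: sorted_wrt_map)
  ultimately have "map ?K (reading_order p \<rho> f) = map ?K w"
    using assms by (intro strict_sorted_equal) auto
  moreover have "inj ?K" by (auto simp: inj_on_def flag_key_def)
  ultimately show "reading_order p \<rho> f = w" using inj_map_eq_map by blast
qed

text \<open>
  The fillings of one reading order \<open>w\<close> are either all flagged partitions or none of them is, so a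
  single flagged partition \<open>g\<close> with this reading order suffices. Through \<open>g\<close> one sees that \<open>w\<close> is
  a linear extension of the poset; then every filling of \<open>w\<close> is weakly increasing along the poset,
  and strictly where the label decreases, because the key decreases there too.
\<close>

lemma reading_order_fibre:
  assumes "partial_order_on {1..p} P" "is_flag p P \<rho>" "g \<in> flagged_partitions p P \<rho>"
    and "w = reading_order p \<rho> g"
  shows "{f \<in> flagged_partitions p P \<rho>. reading_order p \<rho> f = w} =
    compatible_fillings (flag_key \<rho>) (\<lambda>i. nat (\<rho> i)) w"
proof (intro equalityI subsetI)
  have set_w: "set w = {1..p}" using assms(4) by simp
  have bound: "int m \<le> \<rho> i \<longleftrightarrow> m \<le> nat (\<rho> i)" if "i \<in> {1..p}" for i m
  proof -
    have "\<rho> i > 0" using assms(2) that by (simp add: is_flag_def)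
    then show ?thesis by linarith
  qed
  show "f \<in> compatible_fillings (flag_key \<rho>) (\<lambda>i. nat (\<rho> i)) w"
    if f: "f \<in> {f \<in> flagged_partitions p P \<rho>. reading_order p \<rho> f = w}" for f
  proof -
    have "f \<in> {1..p} \<rightarrow>\<^sub>E {1..}" "\<forall>i\<in>{1..p}. int (f i) \<le> \<rho> i"
      using f by (simp_all add: flagged_partitions_def)
    moreover have "compatible (flag_key \<rho>) w f"
      using f reading_order_eq_iff[OF set_w] by blast
    ultimately show ?thesis
      unfolding compatible_fillings_def set_w using bound by blast
  qed
  fix f
  assume f: "f \<in> compatible_fillings (flag_key \<rho>) (\<lambda>i. nat (\<rho> i)) w"
  then have comp: "compatible (flag_key \<rho>) w f" by (simp add: compatible_fillings_def)
  \<comment> \<open>For \<open>g\<close> this inequality follows from the poset; it places \<open>i\<close> before \<open>j\<close> in \<open>w\<close>, and a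
    filling of \<open>w\<close> increases in that order.\<close>
  have less: "(f i, flag_key \<rho> i) < (f j, flag_key \<rho> j)"
    if ij: "i \<in> {1..p}" "j \<in> {1..p}" "strictly_below P i j" for i j
  proof -
    have neq: "i \<noteq> j" using ij by (simp add: strictly_below_def)
    have "g i \<le> g j" "j < i \<Longrightarrow> g i < g j"
      using assms(3) ij by (auto simp: flagged_partitions_def)
    moreover from this(2) have "i < j \<or> g i < g j"
      using neq by linarith
    ultimately have g_less: "(g i, flag_key \<rho> i) < (g j, flag_key \<rho> j)"
      using flag_constant_on_level[OF assms(1,2,3) ij(3)] neq
      by (cases "g i = g j") (auto simp: flag_key_def)
    obtain a b where ab: "a < length w" "i = w ! a" "b < length w" "j = w ! b"
      using ij set_w by (metis in_set_conv_nth)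
    have "\<not> b < a"
    proof
      assume "b < a"
      then have "(g j, flag_key \<rho> j) < (g i, flag_key \<rho> i)"
        using reading_order_sorted[of g \<rho> p] ab
        unfolding assms(4)[symmetric] sorted_wrt_iff_nth_less by blast
      then show False using g_less by (rule less_asym)
    qed
    then have "a < b" using ab neq by (metis linorder_neqE_nat)
    then show ?thesis
      using comp ab unfolding compatible_iff_sorted_wrt sorted_wrt_iff_nth_less by blast
  qed
  have strict: "f i < f j"
    if ij: "i \<in> {1..p}" "j \<in> {1..p}" "strictly_below P i j" "j < i" for i j
    using less[OF ij(1-3)] flag_mono[OF assms(1,2) ij(3)] ij(4) by (auto simp: flag_key_def)
  have weak: "f i \<le> f j"
    if ij: "i \<in> {1..p}" "j \<in> {1..p}" "strictly_below P i j" for i j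
    using less[OF ij] by auto
  have "f \<in> flagged_partitions p P \<rho>"
    using f strict weak bound
    unfolding compatible_fillings_def flagged_partitions_def set_w by blast
  then show "f \<in> {f \<in> flagged_partitions p P \<rho>. reading_order p \<rho> f = w}"
    using comp reading_order_eq_iff[OF set_w] by simp
qed

text \<open>
  Different reading orders may have the same slide index, so the coefficients are multiplicities.
\<close>

lemma slide_positive_sum:
  assumes "finite W" "\<And>w. w \<in> W \<Longrightarrow> g w \<in> slide_index"
  shows "slide_positive (\<Sum>w\<in>W. slide_poly (g w))"
proof -
  have "(\<Sum>w\<in>W. slide_poly (g w)) =
      (\<Sum>a\<in>g ` W. \<Sum>w\<in>{w \<in> W. g w = a}. slide_poly (g w))"
    by (rule sum.image_gen[OF assms(1)])
  also have "\<dots> = (\<Sum>a\<in>g ` W. of_int (int (card {w \<in> W. g w = a})) * slide_poly a)"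
    by (rule sum.cong) auto
  finally show ?thesis
    using assms unfolding slide_positive_def
    by (intro exI[of _ "g ` W"] exI[of _ "\<lambda>a. int (card {w \<in> W. g w = a})"]) auto
qed

theorem theorem1p1:
  fixes p :: nat and P :: "nat rel" and \<rho> :: "nat \<Rightarrow> int"
  assumes "partial_order_on {1..p} P"
    and "is_flag p P \<rho>"
  shows "slide_positive (flagged_poly p P \<rho>)"
proof -
  let ?A = "flagged_partitions p P \<rho>" and ?k = "flag_key \<rho>" and ?R = "\<lambda>i. nat (\<rho> i)"
  let ?W = "reading_order p \<rho> ` ?A"
  have "flagged_poly p P \<rho> =
      (\<Sum>w\<in>?W. \<Sum>f\<in>{f \<in> ?A. reading_order p \<rho> f = w}. \<Prod>i=1..p. Var (f i))"
    unfolding flagged_poly_def by (rule sum.image_gen[OF finite_flagged_partitions])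
  also have "\<dots> = (\<Sum>w\<in>?W. slide_poly (slide_index_of ?k ?R w))"
  proof (rule sum.cong[OF refl])
    fix w assume "w \<in> ?W"
    then obtain g where g: "g \<in> ?A" "w = reading_order p \<rho> g" by blast
    have fibre: "{f \<in> ?A. reading_order p \<rho> f = w} = compatible_fillings ?k ?R w"
      by (rule reading_order_fibre[OF assms g])
    then have "compatible_fillings ?k ?R w \<noteq> {}" using g by blast
    moreover have "?R y \<le> ?R x" if "?k x < ?k y" for x y
      using that by (auto simp: flag_key_def)
    ultimately have "(\<Sum>f\<in>compatible_fillings ?k ?R w. \<Prod>x\<in>set w. Var (f x)) =
        slide_poly (slide_index_of ?k ?R w)"
      using g by (intro sum_compatible_fillings) auto
    then show "(\<Sum>f\<in>{f \<in> ?A. reading_order p \<rho> f = w}. \<Prod>i=1..p. Var (f i)) =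
        slide_poly (slide_index_of ?k ?R w)"
      using g fibre by simp
  qed
  finally show ?thesis
    using slide_positive_sum[of ?W "slide_index_of ?k ?R"]
    by (simp add: finite_flagged_partitions slide_index_of_in_slide_index)
qed

end
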